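(* Let $p \geq 5$ be a prime. Let $S(p) = \{ j \in \{0,1,\ldots,p-1\} : j \equiv \tfrac{1}{2} n(3n-1) \pmod p \text{ for some integer } n\}$, let $i_0 \in \{0,1,\ldots,p-1\}$ be such that $i_0 \equiv -1/24 \pmod p$, and let $S^{\ast}(p) = S(p) \setminus \{i_0\}$. If $j \in \{1, 2, \ldots, p-1-\max S^{\ast}(p)\}$, then $$\xi(p^{\lambda} m - j) \equiv 0 \pmod{p^{\lambda}}$$ for all positive integers $m$ and $\lambda$.
   Context: The Fishburn numbers $\xi(n)$, $n \geq 0$, are defined by the identity of formal power series in $q$ $$\sum_{n\geq 0} \xi(n) q^n = \sum_{n \geq 0} \prod_{j=1}^n \bigl(1 - (1-q)^j\bigr),$$ which is well defined since the $n$-th summand is divisible by $q^n$. Here $-1/24$ modulo $p$ means the residue $x$ with $24x \equiv -1 \pmod p$. *)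

theory Defs
  imports
    "HOL-Computational_Algebra.Computational_Algebra"
    "HOL-Number_Theory.Number_Theory"
begin

text \<open>
  The infinite sum is taken in the \<open>X\<close>-adic topology that the library puts on formal power
  series; \<open>fishburn_sums\<close> below shows that it converges, so that \<open>suminf\<close> is the genuine sum.
\<close>

definition fishburn_summand :: "nat \<Rightarrow> int fps" where
  "fishburn_summand n = (\<Prod>j=1..n. 1 - (1 - fps_X) ^ j)"

definition fishburn_fps :: "int fps" where
  "fishburn_fps = (\<Sum>n. fishburn_summand n)"

definition fishburn :: "nat \<Rightarrow> int" where
  "fishburn n = fps_nth fishburn_fps n"

text \<open>
  Here \<open>n * (3 * n - 1)\<close> is always even, so the integer division is exact.
\<close>

definition pentagonal_residues :: "nat \<Rightarrow> nat set" where
  "pentagonal_residues p =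
     {j \<in> {0..p - 1}. \<exists>n :: int. [int j = n * (3 * n - 1) div 2] (mod int p)}"

lemma fishburn_summand_dvd: "fps_X ^ n dvd fishburn_summand n"
proof -
  have "fps_X dvd (1 - (1 - fps_X) ^ j :: int fps)" for j
  proof -
    have "(1 - (1 - fps_X)) dvd (1 ^ j - (1 - fps_X) ^ j :: int fps)"
      by (metis dvd_triv_left power_diff_sumr2)
    then show ?thesis by simp
  qed
  then have "(\<Prod>j=1..n. fps_X) dvd (\<Prod>j=1..n. (1 - (1 - fps_X) ^ j :: int fps))"
    by (intro prod_dvd_prod)
  then show ?thesis
    by (simp add: fishburn_summand_def)
qed

lemma fishburn_summand_nth_eq_0:
  assumes "k < n"
  shows "fps_nth (fishburn_summand n) k = 0"
proof -
  obtain g where "fishburn_summand n = fps_X ^ n * g"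
    using fishburn_summand_dvd dvdE by blast
  then show ?thesis
    using assms by (simp add: fps_X_power_mult_nth)
qed

lemma fishburn_sums:
  "fishburn_summand sums Abs_fps (\<lambda>k. \<Sum>n\<le>k. fps_nth (fishburn_summand n) k)"
  unfolding sums_def
proof (rule tendsto_fpsI)
  fix k
  show "eventually (\<lambda>N. fps_nth (sum fishburn_summand {..<N}) k =
          fps_nth (Abs_fps (\<lambda>k. \<Sum>n\<le>k. fps_nth (fishburn_summand n) k)) k) sequentially"
    unfolding eventually_sequentially
  proof (intro exI allI impI)
    fix N assume "Suc k \<le> N"
    then have "(\<Sum>n<N. fps_nth (fishburn_summand n) k) =
               (\<Sum>n\<le>k. fps_nth (fishburn_summand n) k)"
      by (intro sum.mono_neutral_right) (auto simp: fishburn_summand_nth_eq_0)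
    then show "fps_nth (sum fishburn_summand {..<N}) k =
          fps_nth (Abs_fps (\<lambda>k. \<Sum>n\<le>k. fps_nth (fishburn_summand n) k)) k"
      by (simp add: fps_sum_nth)
  qed
qed

lemma fishburn_eq_sum: "fishburn k = (\<Sum>n\<le>k. fps_nth (fishburn_summand n) k)"
  by (simp add: fishburn_def fishburn_fps_def flip: sums_unique[OF fishburn_sums])

end

theory Submission
  imports Defs
begin

text \<open>
  Put \<open>q = 1 - X\<close> and \<open>S(x) = (\<Sum>n. (x;q)\<^sub>n\<^sub>+\<^sub>1 x\<^sup>n)\<close>, so that the Fishburn series is \<open>- S'(1)\<close>. The Rogers--Fine
  equation \<open>S(x) = 1 - q x\<^sup>2 - q\<^sup>2 x\<^sup>3 S(q x)\<close> relates \<open>S\<close> and \<open>S'\<close> at \<open>q\<^sup>k\<close> and \<open>q\<^sup>k\<^sup>+\<^sup>1\<close>. Modulo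
  \<open>(p\<^sup>l, X\<^sup>M)\<close> the element \<open>q\<close> has odd finite order \<open>K = p\<^sup>a\<close>, so \<open>K\<close> iterations give a closed finite
  formula: four times the Fishburn series is, up to signs, the sum of \<open>(6 n - 1) (1 - X)\<^sup>e\<close> over pentagonal
  \<open>e = n (3 n - 1) / 2\<close> with \<open>- K < n \<le> K\<close>.

  It remains to see that \<open>p\<^sup>l\<close> divides \<open>(6 n - 1)\<close> times \<open>e\<close> over \<open>N = p\<^sup>l m - j\<close>. Since
  \<open>(N + 1) \<cdots> (N + j)\<close> times \<open>e + j\<close> over \<open>N + j\<close> equals \<open>(e + 1) \<cdots> (e + j)\<close> times \<open>e\<close> over \<open>N\<close>, one
  only has to control the powers of \<open>p\<close> in \<open>(e + 1) \<cdots> (e + j)\<close>. If \<open>e\<close> is not congruent to \<open>-1/24\<close>, the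
  bound on \<open>j\<close> excludes \<open>p\<close>; otherwise \<open>p\<close> divides \<open>6 n - 1\<close> because \<open>24 e + 1 = (6 n - 1)\<^sup>2\<close>, and
  \<open>p\<^sup>2\<close> does not divide the product.
\<close>

subsection \<open>A truncated Rogers--Fine functional equation\<close>

definition qpoch :: "'a::idom \<Rightarrow> nat \<Rightarrow> 'a poly" where
  "qpoch q n = (\<Prod>i<n. [:1, - (q ^ i):])"

definition fine_sum :: "'a::idom \<Rightarrow> nat \<Rightarrow> 'a poly" where
  "fine_sum q N = (\<Sum>n<N. qpoch q (Suc n) * Polynomial.monom 1 n)"

lemma qpoch_Suc: "qpoch q (Suc n) = qpoch q n * [:1, - (q ^ n):]"
  by (simp add: qpoch_def mult.commute)

lemma pcompose_qpoch_scale: "pcompose (qpoch q n) [:0, q:] = (\<Prod>i<n. [:1, - (q ^ Suc i):])"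
  by (simp add: qpoch_def pcompose_prod pcompose_pCons mult.commute)

lemma qpoch_Suc_shift: "qpoch q (Suc n) = [:1, -1:] * pcompose (qpoch q n) [:0, q:]"
  unfolding pcompose_qpoch_scale by (simp add: qpoch_def prod.lessThan_Suc_shift del: prod.lessThan_Suc)

lemma pcompose_monom_scale: "pcompose (Polynomial.monom 1 n) [:0, q:] = Polynomial.monom (q ^ n) n" for q :: "'a::idom"
  by (induction n) (simp_all add: monom_Suc pcompose_pCons pcompose_1 smult_monom mult_monom)

text \<open>Truncating to polynomials keeps the substitution \<open>x \<mapsto> q x\<close> and
  differentiation exact, at the price of an explicit remainder. In the induction step both sides
  gain a multiple of \<open>Q\<close>, and \<open>key\<close> equates the cofactors.\<close>

lemma fine_sum_Suc:
  "fine_sum q (Suc N) = [:1, 0, - q:] - Polynomial.monom (q\<^sup>2) 3 * pcompose (fine_sum q N) [:0, q:]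
     - Polynomial.monom 1 (Suc N) * pcompose (qpoch q (Suc N)) [:0, q:]"
proof (induction N)
  case 0
  show ?case
    by (simp add: fine_sum_def qpoch_def pcompose_pCons monom_Suc)
next
  case (Suc N)
  define Q where "Q = pcompose (qpoch q (Suc N)) [:0, q:]"
  have Q2: "pcompose (qpoch q (Suc (Suc N))) [:0, q:] = Q * [:1, - (q ^ (N+2)):]"
    by (simp add: Q_def pcompose_qpoch_scale mult.commute)
  have S: "qpoch q (Suc (Suc N)) = [:1, -1:] * Q"
    unfolding Q_def by (rule qpoch_Suc_shift)
  have step: "fine_sum q (Suc (Suc N)) = fine_sum q (Suc N) + Q * ([:1, -1:] * Polynomial.monom 1 (Suc N))"
    by (simp only: fine_sum_def sum.lessThan_Suc S mult_ac)
  have step': "pcompose (fine_sum q (Suc N)) [:0, q:] =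
      pcompose (fine_sum q N) [:0, q:] + Q * Polynomial.monom (q ^ N) N"
    by (simp add: fine_sum_def Q_def pcompose_add pcompose_mult pcompose_monom_scale)
  have key: "[:1, -1:] * Polynomial.monom 1 (Suc N) = Polynomial.monom 1 (Suc N)
      - Polynomial.monom 1 (Suc (Suc N)) * [:1, - (q ^ (N+2)):] - Polynomial.monom (q\<^sup>2) 3 * Polynomial.monom (q ^ N) N"
    by (simp add: monom_Suc mult_monom numeral_3_eq_3 power2_eq_square algebra_simps smult_monom
        flip: minus_monom)
  show ?case
    unfolding step step' Q2 key
    unfolding Suc.IH Q_def[symmetric] by (simp only: algebra_simps)
qed

section \<open>Divisibility of values and derivatives of products\<close>

lemma dvd_poly_prod:
  fixes f :: "nat \<Rightarrow> 'a::idom poly"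
  assumes "\<And>i. i < n \<Longrightarrow> t dvd poly (f i) y"
  shows "t ^ n dvd poly (\<Prod>i<n. f i) y"
  unfolding poly_prod using prod_dvd_prod[of "{..<n}" "\<lambda>_. t" "\<lambda>i. poly (f i) y"] assms by simp

text \<open>By the Leibniz rule, differentiation costs only one of the \<open>n + 1\<close> factors
  \<open>t\<close>.\<close>

lemma dvd_poly_pderiv_prod:
  fixes f :: "nat \<Rightarrow> 'a::idom poly"
  assumes "\<And>i. i < Suc n \<Longrightarrow> t dvd poly (f i) y"
  shows "t ^ n dvd poly (pderiv (\<Prod>i<Suc n. f i)) y"
  using assms
proof (induction n)
  case (Suc n)
  have "t ^ Suc n dvd poly (\<Prod>i<Suc n. f i) y"
    using Suc.prems by (intro dvd_poly_prod) simp
  moreover have "t ^ Suc n dvd poly (f (Suc n)) y * poly (pderiv (\<Prod>i<Suc n. f i)) y"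
    unfolding power_Suc using Suc by (intro mult_dvd_mono) auto
  ultimately show ?case
    by (subst prod.lessThan_Suc) (simp add: pderiv_mult del: prod.lessThan_Suc power_Suc)
qed simp

lemma dvd_poly_mult_prod:
  fixes f :: "nat \<Rightarrow> 'a::idom poly"
  assumes "\<And>i. i < Suc n \<Longrightarrow> t dvd poly (f i) y"
  shows "t ^ n dvd poly (h * (\<Prod>i<Suc n. f i)) y"
    and "t ^ n dvd poly (pderiv (h * (\<Prod>i<Suc n. f i))) y"
proof -
  have 1: "t ^ n dvd poly (\<Prod>i<Suc n. f i) y"
    using dvd_poly_prod[of "Suc n" t f y] assms by (simp add: dvd_mult_right del: prod.lessThan_Suc)
  then show "t ^ n dvd poly (h * (\<Prod>i<Suc n. f i)) y"
    by (simp del: prod.lessThan_Suc)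
  show "t ^ n dvd poly (pderiv (h * (\<Prod>i<Suc n. f i))) y"
    using 1 dvd_poly_pderiv_prod[of n t f y] assms by (simp add: pderiv_mult del: prod.lessThan_Suc)
qed

text \<open>
  Adding the multiple \<open>6 k + 1\<close> of \<open>S(x)\<close> to \<open>2 x S'(x)\<close> at \<open>x = q ^ k\<close> cancels all values of \<open>S\<close> in the
  differentiated functional equation and produces the factors \<open>6 k + 1\<close> and \<open>6 k + 5\<close>.
\<close>
definition fine_deriv :: "'a::idom \<Rightarrow> nat \<Rightarrow> nat \<Rightarrow> 'a" where
  "fine_deriv q N k = 2 * q ^ k * poly (pderiv (fine_sum q N)) (q ^ k)
     + of_nat (6 * k + 1) * poly (fine_sum q N) (q ^ k)"

lemma fine_deriv_Suc:
  "(1 - q) ^ N dvd fine_deriv q N k -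
     (of_nat (6 * k + 1) - of_nat (6 * k + 5) * q ^ (2 * k + 1) - q ^ (3 * k + 2) * fine_deriv q N (Suc k))"
proof -
  \<comment> \<open>\<open>R1\<close> is the remainder of \<open>fine_sum_Suc\<close> and
    \<open>R2\<close> the last summand of \<open>fine_sum q (Suc N)\<close>. At
    \<open>x = q ^ k\<close> each of their \<open>N + 1\<close> factors is some
    \<open>1 - q ^ r\<close>, a multiple of \<open>1 - q\<close>.\<close>
  define R1 where "R1 = Polynomial.monom 1 (Suc N) * (\<Prod>i<Suc N. [:1, - (q ^ Suc i):])"
  define R2 where "R2 = Polynomial.monom 1 N * (\<Prod>i<Suc N. [:1, - (q ^ i):])"
  define R where "R = R1 + R2"
  have q1: "(1 - q) dvd 1 - q ^ i" for i
    by (metis power_one power_diff_sumr2 dvd_triv_left)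
  have d: "1 - q dvd poly [:1, - (q ^ i):] (q ^ k)" for i
    using q1[of "i + k"] by (simp add: power_add mult.commute)
  have dR: "(1 - q) ^ N dvd poly R (q ^ k)" "(1 - q) ^ N dvd poly (pderiv R) (q ^ k)"
    unfolding R_def R1_def R2_def poly_add pderiv_add
    by (intro dvd_add dvd_poly_mult_prod d)+
  define G where "G = fine_sum q N"
  have "fine_sum q (Suc N) = G + R2"
    by (simp add: fine_sum_def G_def R2_def qpoch_def mult.commute)
  then have G: "G = [:1, 0, - q:] - Polynomial.monom (q\<^sup>2) 3 * pcompose G [:0, q:] - R"
    using fine_sum_Suc[of q N] unfolding pcompose_qpoch_scale R_def R1_def[symmetric] G_def[symmetric]
    by (simp add: algebra_simps)
  define a where "a = poly G (q ^ k)"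
  define a' where "a' = poly G (q ^ Suc k)"
  define b where "b = poly (pderiv G) (q ^ k)"
  define b' where "b' = poly (pderiv G) (q ^ Suc k)"
  define z where "z = q ^ k"
  have a: "a = 1 - q * z^2 - q^2 * z^3 * a' - poly R z"
    unfolding a_def a'_def z_def
    by (subst G) (simp add: poly_pcompose poly_monom power2_eq_square mult.commute mult.left_commute)
  have "pderiv G = pderiv [:1, 0, - q:] - (pderiv (Polynomial.monom (q\<^sup>2) 3) * pcompose G [:0, q:] +
     Polynomial.monom (q\<^sup>2) 3 * (pcompose (pderiv G) [:0, q:] * [:q:])) - pderiv R"
    by (subst G) (simp add: pderiv_diff pderiv_add pderiv_mult pderiv_pcompose pderiv_pCons algebra_simps)
  then have "b = poly \<dots> z" 
    by (simp add: b_def z_def)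
  also have "\<dots> = - 2 * q * z - (3 * q^2 * z^2 * a' + q^2 * z^3 * (b' * q)) - poly (pderiv R) z"
    by (simp add: a'_def b'_def z_def poly_pcompose poly_monom pderiv_monom pderiv_pCons mult.commute)
  finally have b: "b = \<dots>" .
  have "fine_deriv q N k - (of_nat (6 * k + 1) - of_nat (6 * k + 5) * q ^ (2 * k + 1)
      - q ^ (3 * k + 2) * fine_deriv q N (Suc k))
    = - (2 * z * poly (pderiv R) z + of_nat (6 * k + 1) * poly R z)"
  proof -
    have e: "q ^ (2 * k + 1) = q * z^2" "q ^ (3 * k + 2) = q^2 * z^3"
      by (simp_all add: z_def power_add power_mult power_mult_distrib mult.commute flip: power_mult)
        (simp add: power2_eq_square)
    have *: "fine_deriv q N k = 2 * z * b + of_nat (6 * k + 1) * a"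
       "fine_deriv q N (Suc k) = 2 * (q * z) * b' + of_nat (6 * k + 7) * a'"
      by (simp_all add: fine_deriv_def z_def a_def b_def a'_def b'_def G_def algebra_simps)
    show ?thesis unfolding * e a b
      by (simp add: algebra_simps power2_eq_square power3_eq_cube)
  qed
  then show ?thesis
    using dR by (simp add: z_def)
qed

lemma fine_sum_at_1: "poly (fine_sum q N) 1 = 0"
  by (simp add: fine_sum_def poly_sum qpoch_Suc_shift)

text \<open>Every summand contains the factor \<open>1 - x\<close>, so its derivative at 1 is minus
  the value of its cofactor.\<close>

lemma fine_deriv_0: "fine_deriv q N 0 = - 2 * (\<Sum>n<N. \<Prod>j=1..n. 1 - q ^ j)"
proof -
  have "fine_sum q N = [:1, -1:] * (\<Sum>n<N. pcompose (qpoch q n) [:0, q:] * Polynomial.monom 1 n)"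
    by (simp add: fine_sum_def qpoch_Suc_shift sum_distrib_left mult.assoc del: mult_pCons_left)
  then have "poly (pderiv (fine_sum q N)) 1 = - (\<Sum>n<N. \<Prod>i<n. 1 - q ^ Suc i)"
    by (simp add: pderiv_mult pderiv_pCons pcompose_qpoch_scale poly_sum poly_monom poly_prod
        del: mult_pCons_left)
  also have "(\<lambda>n. \<Prod>i<n. 1 - q ^ Suc i) = (\<lambda>n. \<Prod>j=1..n. 1 - q ^ j)"
    by (intro ext, rule prod.reindex_bij_witness[of _ "\<lambda>j. j - 1" Suc]) auto
  finally show ?thesis
    by (simp add: fine_deriv_def fine_sum_at_1)
qed

subsection \<open>Power series modulo \<open>(P, X\<^sup>M)\<close>\<close>

definition fps_cong :: "nat \<Rightarrow> int \<Rightarrow> int fps \<Rightarrow> int fps \<Rightarrow> bool" where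
  "fps_cong M P f g \<longleftrightarrow> (\<forall>n<M. [fps_nth f n = fps_nth g n] (mod P))"

lemma fps_cong_refl [simp]: "fps_cong M P f f"
  by (simp add: fps_cong_def)

lemma fps_cong_trans [trans]: "fps_cong M P f g \<Longrightarrow> fps_cong M P g h \<Longrightarrow> fps_cong M P f h"
  by (auto simp: fps_cong_def intro: cong_trans)

lemma fps_cong_add:
  "fps_cong M P f g \<Longrightarrow> fps_cong M P f' g' \<Longrightarrow> fps_cong M P (f + f') (g + g')"
  by (auto simp: fps_cong_def intro: cong_add)

lemma fps_cong_mult:
  "fps_cong M P f g \<Longrightarrow> fps_cong M P f' g' \<Longrightarrow> fps_cong M P (f * f') (g * g')"
  by (auto simp: fps_cong_def fps_mult_nth intro!: cong_sum cong_mult)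

lemma fps_cong_power: "fps_cong M P f g \<Longrightarrow> fps_cong M P (f ^ n) (g ^ n)"
  by (induction n) (auto intro: fps_cong_mult)

lemma fps_cong_poly: "fps_cong M P f g \<Longrightarrow> fps_cong M P (poly h f) (poly h g)"
  by (induction h) (auto intro!: fps_cong_add fps_cong_mult)

lemma fps_cong_if_dvd:
  assumes "fps_X ^ M dvd f - g"
  shows "fps_cong M P f g"
proof -
  obtain h where "f = g + fps_X ^ M * h"
    using assms by (metis dvdE add_diff_cancel_left' add.commute diff_add_cancel)
  then show ?thesis
    by (simp add: fps_cong_def fps_X_power_mult_nth)
qed

section \<open>Powers of \<open>1 - X\<close> modulo prime powers\<close>

lemma one_minus_X_power_nth:
  "fps_nth ((1 - fps_X) ^ e :: int fps) n = (- 1) ^ n * int (e choose n)"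
proof -
  have "fps_nth ((1 + fps_const (-1) * fps_X) ^ e :: int fps) n = (- 1) ^ n * int (e choose n)"
  proof (induction e arbitrary: n)
    case (Suc e)
    then show ?case by (cases n) (auto simp: algebra_simps)
  qed (auto simp: )
  then show ?thesis
    by (simp flip: fps_const_neg)
qed

lemma prime_power_dvd_choose_prime_power:
  fixes p :: nat
  assumes "prime p" "0 < i" "i < M"
  shows "p ^ l dvd (p ^ (l + M) choose i)"
proof -
  obtain u where u: "i = p ^ multiplicity p i * u" "\<not> p dvd u"
    using assms by (metis multiplicity_decompose' not_prime_unit neq0_conv)
  define s where "s = multiplicity p i"
  have i: "i = p ^ s * u" using u s_def by simp
  \<comment> \<open>The factor \<open>i\<close> in \<open>i * (p ^ (l + M) choose i)\<close> can
    absorb only \<open>p ^ s\<close>, and \<open>s < p ^ s \<le> i < M\<close> leaves at least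
    \<open>p ^ l\<close>.\<close>
  have "s < 2 ^ s" by simp
  also have "\<dots> \<le> p ^ s" using assms prime_ge_2_nat by (simp add: power_mono)
  also have "\<dots> \<le> i" using assms unfolding i by (cases u) auto
  finally have "s < M" using assms by simp
  have "i * (p ^ (l + M) choose i) = p ^ (l + M) * ((p ^ (l + M) - 1) choose (i - 1))"
    using times_binomial_minus1_eq[of i "p ^ (l + M)"] assms by simp
  then have "p ^ (l + M) dvd u * (p ^ s * (p ^ (l + M) choose i))"
    unfolding i by (metis dvd_triv_left mult.assoc mult.commute)
  then have "p ^ (l + M) dvd p ^ s * (p ^ (l + M) choose i)"
    using u assms by (metis coprime_dvd_mult_right_iff coprime_power_left_iff prime_imp_coprime)
  then have "p ^ s * p ^ l dvd p ^ s * (p ^ (l + M) choose i)"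
    using \<open>s < M\<close> by (metis add.commute le_imp_power_dvd dvd_trans less_imp_le nat_add_left_cancel_le power_add)
  then show ?thesis using assms by (simp add: prime_gt_0_nat)
qed

lemma one_minus_X_power_cong_1:
  assumes "prime p"
  shows "fps_cong M (int (p ^ l)) ((1 - fps_X) ^ (p ^ (l + M))) 1"
  unfolding fps_cong_def one_minus_X_power_nth
proof (intro allI impI)
  fix n assume "n < M"
  show "[(- 1) ^ n * int (p ^ (l + M) choose n) = fps_nth 1 n] (mod int (p ^ l))"
  proof (cases "n = 0")
    case False
    then have "int (p ^ l) dvd int (p ^ (l + M) choose n)"
      using prime_power_dvd_choose_prime_power[OF assms _ \<open>n < M\<close>] by (simp only: of_nat_dvd_iff)
    with False show ?thesis by (simp add: cong_0_iff)
  qed simp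
qed

subsection \<open>The Fishburn series at \<open>1 - X\<close> as a sum over pentagonal exponents\<close>

text \<open>For every integer \<open>n\<close> the product is even and nonnegative, so neither
  \<open>div\<close> nor \<open>nat\<close> loses anything.\<close>

definition pent :: "int \<Rightarrow> nat" where
  "pent n = nat (n * (3 * n - 1) div 2)"

lemma two_pent: "2 * int (pent n) = n * (3 * n - 1)"
proof -
  have "even (n * (3 * n - 1))" by simp
  moreover have "n * (3 * n - 1) \<ge> 0"
    by (cases "n \<ge> 1") (auto simp: zero_le_mult_iff)
  ultimately show ?thesis by (simp add: pent_def)
qed

lemma pent_uminus_Suc: "pent (- int (Suc k)) = pent (- int k) + (3 * k + 2)"
  using two_pent[of "- int (Suc k)"] two_pent[of "- int k"]
  by (simp add: algebra_simps)

lemma pent_Suc: "pent (int (Suc k)) = pent (- int k) + (2 * k + 1)"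
  using two_pent[of "int (Suc k)"] two_pent[of "- int k"]
  by (simp add: algebra_simps)

definition pent_term :: "int \<Rightarrow> int fps" where
  "pent_term n = of_int (6 * n - 1) * (1 - fps_X) ^ pent n"

text \<open>Iterates \<open>fine_deriv_Suc\<close>: the accumulated exponent after \<open>k\<close>
  steps is \<open>pent (- k)\<close>, and \<open>6 k + 1\<close>, \<open>6 k + 5\<close> are
  \<open>-(6 n - 1)\<close> at \<open>n = - k\<close> and \<open>6 n - 1\<close> at
  \<open>n = k + 1\<close>.\<close>

lemma fine_deriv_0_cong:
  defines "q \<equiv> 1 - fps_X :: int fps"
  shows "fps_cong M P (fine_deriv q M 0)
    ((\<Sum>k<K. (- 1) ^ Suc k * (pent_term (- int k) + pent_term (int (Suc k))))
      + (- 1) ^ K * q ^ pent (- int K) * fine_deriv q M K)"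
proof (induction K)
  case (Suc K)
  have "fps_cong M P (fine_deriv q M K) (of_nat (6 * K + 1) - of_nat (6 * K + 5) * q ^ (2 * K + 1)
      - q ^ (3 * K + 2) * fine_deriv q M (Suc K))" (is "fps_cong M P _ ?g")
    using fine_deriv_Suc[of q M K] by (intro fps_cong_if_dvd) (simp add: q_def)
  then have "fps_cong M P (fine_deriv q M 0)
    ((\<Sum>k<K. (- 1) ^ Suc k * (pent_term (- int k) + pent_term (int (Suc k))))
      + (- 1) ^ K * q ^ pent (- int K) * ?g)"
    by (intro fps_cong_trans[OF Suc] fps_cong_add fps_cong_mult) auto
  also have "(- 1) ^ K * q ^ pent (- int K) * ?g =
     (- 1) ^ Suc K * (pent_term (- int K) + pent_term (int (Suc K)))
      + (- 1) ^ Suc K * q ^ pent (- int (Suc K)) * fine_deriv q M (Suc K)"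
    unfolding pent_term_def pent_Suc pent_uminus_Suc q_def[symmetric] power_add
    by (simp add: algebra_simps)
  finally show ?case by (simp add: algebra_simps)
qed (simp add: pent_def)

lemma fine_deriv_0_nth:
  assumes "n < M"
  shows "fps_nth (fine_deriv (1 - fps_X) M 0) n = - 2 * fishburn n"
proof -
  have "(\<Sum>i<M. fps_nth (fishburn_summand i) n) = fishburn n"
    unfolding fishburn_eq_sum using assms
    by (intro sum.mono_neutral_right) (auto simp: fishburn_summand_nth_eq_0)
  then show ?thesis
    by (simp add: fine_deriv_0 fps_sum_nth numeral_fps_const flip: fishburn_summand_def
        del: One_nat_def)
qed

text \<open>
  The choice \<open>K = p ^ (l + M)\<close> makes \<open>q ^ K \<equiv> 1\<close> for \<open>q = 1 - X\<close>, so that the recursion closes up;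
  as \<open>K\<close> is odd, it returns to its starting value with the opposite sign.
\<close>
lemma four_fishburn_cong:
  fixes p l M n :: nat
  assumes "prime p" "odd p"
  defines "K \<equiv> p ^ (l + M)"
  assumes n: "n < M"
  shows "[4 * fishburn n =
    (\<Sum>k<K. fps_nth ((- 1) ^ k * (pent_term (- int k) + pent_term (int (Suc k)))) n)] (mod int (p ^ l))"
proof -
  define q where "q = (1 - fps_X :: int fps)"
  let ?P = "int (p ^ l)"
  have qK: "fps_cong M ?P (q ^ K) 1"
    unfolding q_def K_def by (rule one_minus_X_power_cong_1) fact
  have "fps_cong M ?P (fine_deriv q M K)
      (2 * 1 * poly (pderiv (fine_sum q M)) 1 + of_nat (6 * K + 1) * poly (fine_sum q M) 1)"
    unfolding fine_deriv_def by (intro fps_cong_add fps_cong_mult fps_cong_poly qK fps_cong_refl)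
  also have "\<dots> = fine_deriv q M 0"
    by (simp add: fine_deriv_def fine_sum_at_1)
  finally have g: "fps_cong M ?P (fine_deriv q M K) (fine_deriv q M 0)" .
  \<comment> \<open>The odd number \<open>K\<close> divides \<open>2 * pent (- K)\<close>; hence the
    prefactor \<open>q ^ pent (- K)\<close> is congruent to 1 too.\<close>
  have "K dvd pent (- int K)"
  proof -
    have "int K dvd 2 * int (pent (- int K))"
      by (simp add: two_pent)
    then show ?thesis using assms
      by (metis K_def coprime_commute coprime_dvd_mult_right_iff coprime_left_2_iff_odd even_power
          int_dvd_int_iff int_ops(3) of_nat_mult)
  qed
  then have e: "fps_cong M ?P (q ^ pent (- int K)) 1"
    using fps_cong_power[OF qK] by (auto elim!: dvdE simp: power_mult)
  let ?S = "\<Sum>k<K. (- 1) ^ Suc k * (pent_term (- int k) + pent_term (int (Suc k)))"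
  have "fps_cong M ?P (fine_deriv q M 0) (?S + (- 1) ^ K * q ^ pent (- int K) * fine_deriv q M K)"
    unfolding q_def by (rule fine_deriv_0_cong)
  also have "fps_cong M ?P \<dots> (?S + (- 1) ^ K * 1 * fine_deriv q M 0)"
    by (intro fps_cong_add fps_cong_mult g e fps_cong_refl)
  also have "(- 1) ^ K * 1 * fine_deriv q M 0 = - fine_deriv q M 0"
    using assms by (simp add: K_def)
  finally have "[- 2 * fishburn n = fps_nth ?S n + 2 * fishburn n] (mod ?P)"
    using n by (simp add: fps_cong_def fine_deriv_0_nth q_def)
  then have "?P dvd - (4 * fishburn n - (- fps_nth ?S n))"
    by (simp add: cong_iff_dvd_diff algebra_simps)
  then have "[4 * fishburn n = - fps_nth ?S n] (mod ?P)"
    by (simp only: cong_iff_dvd_diff dvd_minus_iff)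
  also have "- fps_nth ?S n =
      (\<Sum>k<K. fps_nth ((- 1) ^ k * (pent_term (- int k) + pent_term (int (Suc k)))) n)"
    by (simp add: fps_sum_nth sum_negf)
  finally show ?thesis .
qed

subsection \<open>Divisibility of binomial coefficients\<close>

text \<open>Iterated absorption moves the product from \<open>n\<close> to \<open>e\<close>, and
  \<open>n + j\<close> is one of its original factors.\<close>

lemma dvd_prod_times_choose:
  fixes e n j :: nat
  assumes "0 < j"
  shows "(n + j) dvd (\<Prod>t=1..j. e + t) * (e choose n)"
proof -
  have "(\<Prod>t=1..j. n + t) * ((e + j) choose (n + j)) = (\<Prod>t=1..j. e + t) * (e choose n)" for j
  proof (induction j)
    case (Suc j)
    have P: "(\<Prod>t=1..Suc j. a + t) = (a + Suc j) * (\<Prod>t=1..j. a + t)" for a :: nat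
      by (simp add: prod.nat_ivl_Suc')
    have "(n + Suc j) * ((e + Suc j) choose (n + Suc j)) = (e + Suc j) * ((e + j) choose (n + j))"
      using Suc_times_binomial_eq[of "e + j" "n + j"] by (simp add: mult.commute)
    then have "(\<Prod>t=1..j. n + t) * ((n + Suc j) * ((e + Suc j) choose (n + Suc j))) =
        (e + Suc j) * ((\<Prod>t=1..j. n + t) * ((e + j) choose (n + j)))"
      by (simp only: mult_ac)
    then show ?case
      unfolding P Suc by (simp only: mult_ac)
  qed simp
  moreover have "(n + j) dvd (\<Prod>t=1..j. n + t)"
    using assms by (intro dvd_prodI) auto
  ultimately show ?thesis by (metis dvd_mult2)
qed

lemma square_mod_24:
  fixes n :: int
  assumes "odd n" "\<not> 3 dvd n"
  shows "[n ^ 2 = 1] (mod 24)"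
proof -
  have "n mod 24 = 1 \<or> n mod 24 = 5 \<or> n mod 24 = 7 \<or> n mod 24 = 11 \<or>
      n mod 24 = 13 \<or> n mod 24 = 17 \<or> n mod 24 = 19 \<or> n mod 24 = 23"
    using assms by presburger
  then have "(n mod 24) ^ 2 mod 24 = 1" by auto
  then show ?thesis by (simp add: cong_def power_mod)
qed

lemma pent_square: "24 * int (pent n) + 1 = (6 * n - 1)\<^sup>2"
  using two_pent[of n] by (simp add: power2_eq_square algebra_simps)

lemma pent_mod_in_pentagonal_residues:
  assumes "p > 0"
  shows "pent n mod p \<in> pentagonal_residues p"
proof -
  have "int (pent n) = n * (3 * n - 1) div 2"
    using two_pent[of n] by simp
  then have "[int (pent n mod p) = n * (3 * n - 1) div 2] (mod int p)"
    by (simp add: cong_def zmod_int)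
  then show ?thesis
    using assms less_Suc_eq_le[of "pent n mod p" "p - 1"] by (auto simp: pentagonal_residues_def)
qed

text \<open>
  If \<open>p\<^sup>2\<close> divided \<open>e + t\<close> with \<open>24 * e + 1 = p\<^sup>2 * c\<^sup>2\<close>, then \<open>24 * t - 1\<close> would be a positive
  multiple of \<open>p\<^sup>2\<close>, congruent to \<open>-1\<close> modulo 24, hence at least \<open>23 * p\<^sup>2\<close>.
\<close>
lemma not_square_dvd_pent_add:
  fixes p t :: nat
  assumes p: "prime p" "p \<ge> 5" and n: "int p dvd 6 * n - 1" and t: "0 < t" "t < p"
  shows "\<not> p\<^sup>2 dvd pent n + t"
proof
  assume "p\<^sup>2 dvd pent n + t"
  then have "int (p\<^sup>2) dvd int (pent n + t)"
    by (simp only: of_nat_dvd_iff)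
  then have "int p ^ 2 dvd 24 * (int (pent n) + int t)"
    by (metis dvd_mult of_nat_add of_nat_power)
  moreover have "int p ^ 2 dvd 24 * int (pent n) + 1"
    unfolding pent_square using n by (rule dvd_power_same)
  ultimately have "int p ^ 2 dvd 24 * (int (pent n) + int t) - (24 * int (pent n) + 1)"
    by (rule dvd_diff)
  then have "int p ^ 2 dvd 24 * int t - 1"
    by (simp add: algebra_simps)
  then obtain s where s: "24 * int t - 1 = int p ^ 2 * s" by (elim dvdE)
  have "odd (int p)" "\<not> 3 dvd int p"
    using p primes_dvd_imp_eq[of 2 p] primes_dvd_imp_eq[of 3 p] int_dvd_int_iff[of 3 p] by auto
  then have "[int p ^ 2 * s = 1 * s] (mod 24)"
    by (intro cong_mult square_mod_24 cong_refl)
  then have "[24 * int t - 1 = s] (mod 24)"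
    by (simp add: s)
  then have "24 dvd 24 * int t - (s + 1)"
    by (simp add: cong_iff_dvd_diff algebra_simps)
  then have "24 dvd s + 1"
    by presburger
  moreover have "s > 0"
    using s t p by (smt (verit) of_nat_0_less_iff zero_less_mult_iff zero_le_power2)
  ultimately have "s \<ge> 23" by presburger
  \<comment> \<open>Size contradiction: \<open>t < p\<close> makes \<open>24 * t - 1\<close> smaller
    than \<open>24 * p\<close>.\<close>
  have "24 * int p \<le> int p * int p * 5"
    using p by (simp add: mult.commute mult.left_commute)
  also have "\<dots> \<le> int p ^ 2 * s"
    using \<open>s \<ge> 23\<close> by (simp add: power2_eq_square mult_left_mono)
  finally show False using s t by linarith
qed

lemma pent_choose_dvd:
  fixes p i0 j l N :: nat
  assumes p: "prime p" "p \<ge> 5"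
    and i0: "i0 < p" "[24 * int i0 = - 1] (mod int p)"
    and j: "0 < j" "j < p" "\<And>i. i \<in> pentagonal_residues p - {i0} \<Longrightarrow> i + j < p"
    and N: "p ^ l dvd N + j"
  shows "int (p ^ l) dvd (6 * n - 1) * int (pent n choose N)"
proof -
  define e where "e = pent n"
  have dvd: "p ^ l dvd (\<Prod>t=1..j. e + t) * (e choose N)"
    using dvd_prod_times_choose[OF \<open>0 < j\<close>] N dvd_trans by blast
  have cop: "coprime (p ^ l) x" if "\<not> p dvd x" for x
    using that p by (simp add: prime_imp_coprime)
  show ?thesis
  proof (cases "\<exists>t\<in>{1..j}. p dvd e + t")
    case False
    then have "\<not> p dvd (\<Prod>t=1..j. e + t)"
      using p by (simp add: prime_dvd_prod_iff)
    then have "p ^ l dvd (e choose N)"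
      using dvd cop coprime_dvd_mult_right_iff by blast
    then have "int (p ^ l) dvd int (e choose N)"
      by (simp only: of_nat_dvd_iff)
    then show ?thesis by (simp add: e_def)
  next
    case True
    then obtain t where t: "t \<in> {1..j}" "p dvd e + t" by blast
    \<comment> \<open>Otherwise the bound on \<open>j\<close> keeps \<open>e mod p + t\<close>
      strictly between 0 and \<open>p\<close>.\<close>
    have "e mod p = i0"
    proof (rule ccontr)
      assume "e mod p \<noteq> i0"
      then have "e mod p + j < p"
        using j(3) pent_mod_in_pentagonal_residues[of p n] p by (simp add: e_def)
      then have "(e mod p + t) mod p = e mod p + t"
        using t by simp
      then show False
        using t by (simp add: dvd_eq_mod_eq_0 mod_add_left_eq)
    qed
    then have "[int e = int i0] (mod int p)"
      by (auto simp: cong_def zmod_int)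
    then have "[24 * int e + 1 = 24 * int i0 + 1] (mod int p)"
      by (intro cong_add cong_mult cong_refl)
    also have "[24 * int i0 + 1 = - 1 + 1] (mod int p)"
      by (intro cong_add i0 cong_refl)
    finally have "int p dvd (6 * n - 1)\<^sup>2"
      by (simp add: cong_0_iff e_def pent_square)
    then have n: "int p dvd 6 * n - 1"
      using p by (simp add: prime_dvd_power_iff)
    \<comment> \<open>Two multiples of \<open>p\<close> cannot differ by less than \<open>p\<close>,
      so \<open>e + t\<close> is the only one; its single factor \<open>p\<close> is paid for by
      \<open>6 n - 1\<close>.\<close>
    have "\<not> p dvd e + s" if s: "s \<in> {1..j} - {t}" for s
    proof
      assume "p dvd e + s"
      then have "int p dvd int (e + s)" "int p dvd int (e + t)"
        using t by (simp_all only: of_nat_dvd_iff)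
      then have "int p dvd int (e + s) - int (e + t)"
        by (rule dvd_diff)
      then have "int p dvd int s - int t" by simp
      moreover have "\<bar>int s - int t\<bar> < int p" "int s - int t \<noteq> 0"
        using s t j by auto
      ultimately show False
        by (meson zdvd_not_zless abs_dvd_iff dvd_abs_iff zero_less_abs_iff)
    qed
    then have *: "\<not> p dvd (\<Prod>s\<in>{1..j} - {t}. e + s)"
      using p by (simp add: prime_dvd_prod_iff)
    obtain w where w: "e + t = p * w" using t by (elim dvdE)
    have "\<not> p dvd w"
      using not_square_dvd_pent_add[OF p n, of t] t j w by (auto simp: e_def power2_eq_square)
    have "(\<Prod>t=1..j. e + t) = p * w * (\<Prod>s\<in>{1..j} - {t}. e + s)"
      using t w by (subst prod.remove[of _ t]) auto
    then have "p ^ l dvd w * ((\<Prod>s\<in>{1..j} - {t}. e + s) * (p * (e choose N)))"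
      using dvd by (simp add: mult_ac)
    then have "p ^ l dvd p * (e choose N)"
      using cop[OF *] cop[OF \<open>\<not> p dvd w\<close>] coprime_dvd_mult_right_iff by blast
    then have "int (p ^ l) dvd int (p * (e choose N))"
      by (simp only: of_nat_dvd_iff)
    also have "int (p * (e choose N)) dvd (6 * n - 1) * int (e choose N)"
      using n by (simp add: mult_dvd_mono)
    finally show ?thesis by (simp add: e_def)
  qed
qed

theorem theorem2:
  fixes p i0 j m l :: nat
  assumes "prime p" and "p \<ge> 5"
    and "i0 \<in> {0..p - 1}" and "[24 * int i0 = - 1] (mod int p)"
    and "j \<in> {1..p - 1 - Max (pentagonal_residues p - {i0})}"
    and "m > 0" and "l > 0"
  shows "[fishburn (p ^ l * m - j) = 0] (mod int (p ^ l))"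
proof -
  define N where "N = p ^ l * m - j"
  have odd: "odd p"
    using assms(1,2) primes_dvd_imp_eq[of 2 p] by auto
  have jp: "0 < j" "j < p" using assms by auto
  \<comment> \<open>Ensures that the subtraction of natural numbers in \<open>N\<close> does not
    truncate.\<close>
  have "p \<le> p ^ l" using assms by (simp add: self_le_power)
  also have "p ^ l \<le> p ^ l * m" using assms by simp
  finally have N: "N + j = p ^ l * m" using jp by (simp add: N_def)
  have lt: "i + j < p" if "i \<in> pentagonal_residues p - {i0}" for i
  proof -
    have "finite (pentagonal_residues p)" by (simp add: pentagonal_residues_def)
    then have "i \<le> Max (pentagonal_residues p - {i0})"
      using that by simp
    then show ?thesis using assms(2,5) by auto
  qed
  have dvd: "int (p ^ l) dvd fps_nth (pent_term n) N" for n
  proof -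
    have "fps_nth (pent_term n) N = (- 1) ^ N * ((6 * n - 1) * int (pent n choose N))"
      unfolding pent_term_def fps_of_int[symmetric] fps_mult_left_const_nth one_minus_X_power_nth
      by (simp add: mult_ac)
    moreover have "int (p ^ l) dvd (6 * n - 1) * int (pent n choose N)"
      using assms jp lt N by (intro pent_choose_dvd[of p i0 j]) auto
    ultimately show ?thesis by (simp only: dvd_mult)
  qed
  have dvd': "int (p ^ l) dvd fps_nth ((- 1) ^ k * (pent_term n + pent_term n')) N" for k n n'
    using dvd[of n] dvd[of n'] by (cases "even k") (auto intro!: dvd_add dvd_diff)
  \<comment> \<open>Truncation order \<open>N + 1\<close> is the least that retains the coefficient
    at \<open>N\<close>.\<close>
  define K where "K = p ^ (l + Suc N)"
  have "[4 * fishburn N =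
    (\<Sum>k<K. fps_nth ((- 1) ^ k * (pent_term (- int k) + pent_term (int (Suc k)))) N)] (mod int (p ^ l))"
    unfolding K_def using four_fishburn_cong[OF assms(1) odd lessI] .
  moreover have "[(\<Sum>k<K. fps_nth ((- 1) ^ k * (pent_term (- int k) + pent_term (int (Suc k)))) N) = 0]
      (mod int (p ^ l))"
    unfolding cong_0_iff by (intro dvd_sum dvd')
  ultimately have "int (p ^ l) dvd 2 ^ 2 * fishburn N"
    unfolding cong_0_iff[symmetric] by (auto intro: cong_trans)
  moreover have "coprime (int (p ^ l)) (2 ^ 2)"
    unfolding coprime_power_right_iff using odd by (simp add: coprime_right_2_iff_odd)
  ultimately have "int (p ^ l) dvd fishburn N"
    using coprime_dvd_mult_right_iff by blast
  then show ?thesis by (simp add: cong_0_iff N_def)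
qed

end
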